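(* Let $\mathbb{M}$ be a compact homogeneous Riemannian manifold with metric $g_{ij}$, let $\mathbb{L}$ be a $C^\infty$ Riemannian manifold with metric $h_{ij}$, and let $F:\mathbb{M}\to\mathbb{L}$ be a $C^\infty$ diffeomorphism. Let $X$ denote the set of centers on $\mathbb{L}$ and let $X'=F^{-1}(X)$ be the corresponding set on $\mathbb{M}$. Suppose that we have a quadrature formula for $\mathbb{M}$ with weights $\{C_{\xi'}\}_{\xi'\in X'}$. Then we have the following quadrature formula for $\mathbb{L}$: $$Q_{\mathbb{L}}(f):=\sum_{\xi\in X}f(\xi)\,c_\xi,\qquad\text{where } c_\xi:=W(F^{-1}(\xi))\,C_{F^{-1}(\xi)}.$$
   Context: A quadrature formula for a Riemannian manifold with Riemannian measure $\mu$, with finite set of centers (nodes) $Y$ and weights $\{w_\eta\}_{\eta\in Y}$, is an approximation of $\int u\,d\mu$ by $\sum_{\eta\in Y}w_\eta u(\eta)$ for continuous functions $u$. The function $W:\mathbb{M}\to(0,\infty)$ is the ratio of the volume elements of $\mathbb{L}$ and $\mathbb{M}$, defined as follows: for a local chart $(U,\phi)$ of $\mathbb{M}$, use the chart $(F(U),\phi\circ F^{-1})$ on $\mathbb{L}$, so that both metrics are expressed in the same coordinates $x$; then $W(p)=\sqrt{\det(h_{ij}(x))/\det(g_{ij}(x))}$ at $x=\phi(p)$. This value does not depend on the choice of chart. *)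

theory Defs
  imports "HOL-Analysis.Analysis"
begin

section \<open>Smooth functions on open subsets of a Euclidean space\<close>

text \<open>Only used for open \<open>S\<close>: \<open>f\<close> is differentiable and all its first partial derivatives are
  again of class \<open>C\<^sup>k\<close>.\<close>

primrec Ck_on :: "nat \<Rightarrow> ('v::euclidean_space \<Rightarrow> 'w::real_normed_vector) \<Rightarrow> 'v set \<Rightarrow> bool" where
  "Ck_on 0 f S \<longleftrightarrow> continuous_on S f"
| "Ck_on (Suc k) f S \<longleftrightarrow> (\<forall>x\<in>S. f differentiable (at x)) \<and>
     (\<forall>b\<in>Basis. Ck_on k (\<lambda>x. frechet_derivative f (at x) b) S)"

definition smooth_on :: "('v::euclidean_space \<Rightarrow> 'w::real_normed_vector) \<Rightarrow> 'v set \<Rightarrow> bool" where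
  "smooth_on f S \<longleftrightarrow> (\<forall>k. Ck_on k f S)"

section \<open>Smooth manifolds\<close>

text \<open>The points of a manifold are the elements of a Hausdorff, second countable type. A chart
  \<open>(U, \<phi>)\<close> carries a total function \<open>\<phi>\<close>, of which only the values on \<open>U\<close> matter; the inverse
  of the coordinate map is \<open>inv_into U \<phi>\<close>, defined on \<open>\<phi> ` U\<close>.\<close>

type_synonym ('a, 'n) chart = "'a set \<times> ('a \<Rightarrow> real ^ 'n)"

definition is_chart :: "('a::topological_space, 'n::finite) chart \<Rightarrow> bool" where
  "is_chart = (\<lambda>(U, \<phi>). open U \<and> open (\<phi> ` U) \<and> homeomorphism U (\<phi> ` U) \<phi> (inv_into U \<phi>))"

definition transition :: "('a, 'n) chart \<Rightarrow> ('a, 'n) chart \<Rightarrow> real ^ 'n \<Rightarrow> real ^ 'n" where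
  "transition = (\<lambda>(U, \<phi>) (V, \<psi>). \<psi> \<circ> inv_into U \<phi>)"

definition compatible :: "('a, 'n::finite) chart \<Rightarrow> ('a, 'n) chart \<Rightarrow> bool" where
  "compatible = (\<lambda>(U, \<phi>) (V, \<psi>).
     smooth_on (transition (U, \<phi>) (V, \<psi>)) (\<phi> ` (U \<inter> V)) \<and>
     smooth_on (transition (V, \<psi>) (U, \<phi>)) (\<psi> ` (U \<inter> V)))"

text \<open>The atlas is required to be maximal, so that ``a local chart'' is exactly an element of it.\<close>

definition maximal_atlas :: "('a::topological_space, 'n::finite) chart set \<Rightarrow> bool" where
  "maximal_atlas A \<longleftrightarrow>
     (\<forall>c\<in>A. is_chart c) \<and>
     (\<Union>(fst ` A) = UNIV) \<and>
     (\<forall>c\<in>A. \<forall>d\<in>A. compatible c d) \<and>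
     (\<forall>c. is_chart c \<and> (\<forall>d\<in>A. compatible c d) \<longrightarrow> c \<in> A)"

section \<open>Riemannian manifolds\<close>

text \<open>\<open>metric M (U, \<phi>) x\<close> is the matrix \<open>(g\<^sub>i\<^sub>j(x))\<close> of the metric in the coordinates \<open>x = \<phi> p\<close>, for
  \<open>p \<in> U\<close>.\<close>

record ('a, 'n) manifold =
  charts :: "('a, 'n) chart set"
  metric :: "('a, 'n) chart \<Rightarrow> real ^ 'n \<Rightarrow> real ^ 'n ^ 'n"

definition positive_definite :: "real ^ 'n ^ 'n::finite \<Rightarrow> bool" where
  "positive_definite G \<longleftrightarrow> transpose G = G \<and> (\<forall>v. v \<noteq> 0 \<longrightarrow> v \<bullet> (G *v v) > 0)"

text \<open>The last clause is the transformation law of a covariant 2-tensor.\<close>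

definition riemannian_manifold ::
    "('a::{t2_space,second_countable_topology}, 'n::finite) manifold \<Rightarrow> bool" where
  "riemannian_manifold M \<longleftrightarrow>
     maximal_atlas (charts M) \<and>
     (\<forall>(U, \<phi>)\<in>charts M. smooth_on (metric M (U, \<phi>)) (\<phi> ` U) \<and>
        (\<forall>x\<in>\<phi> ` U. positive_definite (metric M (U, \<phi>) x))) \<and>
     (\<forall>(U, \<phi>)\<in>charts M. \<forall>(V, \<psi>)\<in>charts M. \<forall>p\<in>U \<inter> V.
        let J = jacobian (transition (U, \<phi>) (V, \<psi>)) (at (\<phi> p))
        in metric M (U, \<phi>) (\<phi> p) = transpose J ** metric M (V, \<psi>) (\<psi> p) ** J)"

definition smooth_map ::
    "('a::topological_space, 'n::finite) manifold \<Rightarrow> ('b::topological_space, 'n) manifold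
      \<Rightarrow> ('a \<Rightarrow> 'b) \<Rightarrow> bool" where
  "smooth_map M L F \<longleftrightarrow> continuous_on UNIV F \<and>
     (\<forall>(U, \<phi>)\<in>charts M. \<forall>(V, \<psi>)\<in>charts L.
        smooth_on (\<psi> \<circ> F \<circ> inv_into U \<phi>) (\<phi> ` (U \<inter> F -` V)))"

definition diffeomorphism ::
    "('a::topological_space, 'n::finite) manifold \<Rightarrow> ('b::topological_space, 'n) manifold
      \<Rightarrow> ('a \<Rightarrow> 'b) \<Rightarrow> bool" where
  "diffeomorphism M L F \<longleftrightarrow> bij F \<and> smooth_map M L F \<and> smooth_map L M (inv F)"

definition isometry_of :: "('a::topological_space, 'n::finite) manifold \<Rightarrow> ('a \<Rightarrow> 'a) \<Rightarrow> bool" where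
  "isometry_of M \<sigma> \<longleftrightarrow> diffeomorphism M M \<sigma> \<and>
     (\<forall>(U, \<phi>)\<in>charts M. \<forall>(V, \<psi>)\<in>charts M. \<forall>p\<in>U \<inter> \<sigma> -` V.
        let J = jacobian (\<psi> \<circ> \<sigma> \<circ> inv_into U \<phi>) (at (\<phi> p))
        in metric M (U, \<phi>) (\<phi> p) = transpose J ** metric M (V, \<psi>) (\<psi> (\<sigma> p)) ** J)"

text \<open>The isometry group acts transitively.\<close>

definition homogeneous :: "('a::topological_space, 'n::finite) manifold \<Rightarrow> bool" where
  "homogeneous M \<longleftrightarrow> (\<forall>p q. \<exists>\<sigma>. isometry_of M \<sigma> \<and> \<sigma> p = q)"

text \<open>\<open>\<mu>\<close> is the Riemannian measure of \<open>M\<close>: the Borel measure given in every chart by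
  \<open>d\<mu> = sqrt (det (g\<^sub>i\<^sub>j(x))) dx\<close>. As countably many charts cover \<open>M\<close>, this determines \<open>\<mu>\<close>.\<close>

definition riemannian_measure ::
    "('a::topological_space, 'n::finite) manifold \<Rightarrow> 'a measure \<Rightarrow> bool" where
  "riemannian_measure M \<mu> \<longleftrightarrow> sets \<mu> = sets borel \<and>
     (\<forall>(U, \<phi>)\<in>charts M. \<forall>B\<in>sets borel. B \<subseteq> U \<longrightarrow>
        emeasure \<mu> B = (\<integral>\<^sup>+x\<in>\<phi> ` B. ennreal (sqrt (det (metric M (U, \<phi>) x))) \<partial>lborel))"

text \<open>The function \<open>W\<close>. The chart \<open>(F ` U, \<phi> \<circ> inv F)\<close> of \<open>L\<close> gives \<open>F p\<close> the same coordinates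
  \<open>\<phi> p\<close> that \<open>(U, \<phi>)\<close> gives \<open>p\<close>; the value does not depend on the chart chosen around \<open>p\<close>.\<close>

definition volume_ratio ::
    "('a, 'n::finite) manifold \<Rightarrow> ('b, 'n) manifold \<Rightarrow> ('a \<Rightarrow> 'b) \<Rightarrow> 'a \<Rightarrow> real" where
  "volume_ratio M L F p =
     (let (U, \<phi>) = (SOME c. c \<in> charts M \<and> p \<in> fst c); x = \<phi> p
      in sqrt (det (metric L (F ` U, \<phi> \<circ> inv F) x) / det (metric M (U, \<phi>) x)))"

section \<open>Quadrature formulas\<close>

definition quadrature_sum :: "'a set \<Rightarrow> ('a \<Rightarrow> real) \<Rightarrow> ('a \<Rightarrow> real) \<Rightarrow> real" where
  "quadrature_sum Y w u = (\<Sum>\<eta>\<in>Y. w \<eta> * u \<eta>)"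

text \<open>The sense in which the quadrature sum approximates the integral is made explicit by an
  arbitrary functional \<open>E\<close> bounding the error: \<open>E u = 0\<close> means that the formula is exact
  for \<open>u\<close>, and \<open>E u = K * norm u\<close>, for some norm, is a typical error estimate.\<close>

definition quadrature_formula ::
    "'a::topological_space measure \<Rightarrow> 'a set \<Rightarrow> ('a \<Rightarrow> real) \<Rightarrow> (('a \<Rightarrow> real) \<Rightarrow> real) \<Rightarrow> bool" where
  "quadrature_formula \<mu> Y w E \<longleftrightarrow> finite Y \<and>
     (\<forall>u. continuous_on UNIV u \<longrightarrow> \<bar>(\<integral>x. u x \<partial>\<mu>) - quadrature_sum Y w u\<bar> \<le> E u)"

end

theory Submission
  imports Defs
begin

text \<open>Transporting charts of \<open>M\<close> along \<open>F\<close> expresses both Riemannian measures in the same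
  coordinates, where their densities differ by the factor \<open>W\<close>. Hence \<open>\<nu>\<close> is the image under \<open>F\<close>
  of the measure with density \<open>W\<close> with respect to \<open>\<mu>\<close>, so \<open>\<integral>f d\<nu> = \<integral>W \<sqdot> (f \<circ> F) d\<mu>\<close>, and as \<open>W\<close> is
  continuous the given formula applies to \<open>W \<sqdot> (f \<circ> F)\<close>.\<close>

section \<open>Locality of derivatives, positive determinants, equality of Borel measures\<close>

lemma has_derivative_cong_open:
  assumes "open T" "x \<in> T" "\<And>y. y \<in> T \<Longrightarrow> f y = g y"
  shows "(f has_derivative D) (at x) \<longleftrightarrow> (g has_derivative D) (at x)"
  using has_derivative_transform_within_open[OF _ assms(1,2), of f D UNIV g]
    has_derivative_transform_within_open[OF _ assms(1,2), of g D UNIV f] assms(3)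
  by auto

lemma frechet_derivative_cong_open:
  assumes "open T" "x \<in> T" "\<And>y. y \<in> T \<Longrightarrow> f y = g y"
  shows "frechet_derivative f (at x) = frechet_derivative g (at x)"
  unfolding frechet_derivative_def using has_derivative_cong_open[OF assms] by simp

text \<open>A derivative at a point only sees values near it, so agreement on an open set around
  \<open>S\<close> passes to all iterated partial derivatives. This allows for coordinate maps whose
  values are controlled only on a chart domain.\<close>

lemma Ck_on_cong:
  assumes "open T" "S \<subseteq> T" "\<And>y. y \<in> T \<Longrightarrow> f y = g y"
  shows "Ck_on k f S \<longleftrightarrow> Ck_on k g S"
  using assms(3)
proof (induction k arbitrary: f g)
  case 0
  have "continuous_on S f \<longleftrightarrow> continuous_on S g"
    by (rule continuous_on_cong) (use assms(2) 0 in auto)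
  then show ?case
    by simp
next
  case (Suc k)
  have "f differentiable (at x) \<longleftrightarrow> g differentiable (at x)" if "x \<in> S" for x
    unfolding differentiable_def
    by (intro iff_exI has_derivative_cong_open[OF assms(1) _ Suc.prems] subsetD[OF assms(2) that])
  moreover have "Ck_on k (\<lambda>x. frechet_derivative f (at x) b) S \<longleftrightarrow>
      Ck_on k (\<lambda>x. frechet_derivative g (at x) b) S" for b
    by (rule Suc.IH) (simp add: frechet_derivative_cong_open[OF assms(1) _ Suc.prems])
  ultimately show ?case
    by simp
qed

lemma smooth_on_cong:
  assumes "open T" "S \<subseteq> T" "\<And>y. y \<in> T \<Longrightarrow> f y = g y"
  shows "smooth_on f S \<longleftrightarrow> smooth_on g S"
  using Ck_on_cong[OF assms] by (simp add: smooth_on_def)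

lemma smooth_on_imp_continuous_on: "smooth_on f S \<Longrightarrow> continuous_on S f"
  unfolding smooth_on_def by (drule spec[of _ 0]) simp

text \<open>On the segment from the identity to \<open>G\<close> every matrix is positive definite,
  hence nonsingular. A nonpositive \<open>det G\<close> would force the determinant, which is 1 at
  the identity, to vanish somewhere on the segment.\<close>

lemma det_pos_if_positive_definite:
  fixes G :: "real ^ 'n::finite ^ 'n"
  assumes "positive_definite G"
  shows "0 < det G"
proof (rule ccontr)
  assume neg: "\<not> 0 < det G"
  define P where "P t = t *\<^sub>R G + (1 - t) *\<^sub>R mat 1" for t :: real
  have "continuous_on {0..1} (\<lambda>t. det (P t))"
    unfolding det_def P_def by (intro continuous_intros)
  then obtain t where t: "0 \<le> t" "t \<le> 1" and P0: "det (P t) = 0"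
    using IVT2'[of "\<lambda>t. det (P t)" 1 0 0] neg by (auto simp: P_def)
  obtain v where "v \<noteq> 0" and v: "P t *v v = 0"
    using P0 by (metis invertible_det_nz matrix_left_invertible_ker invertible_left_inverse)
  have "0 = v \<bullet> (P t *v v)"
    using v by simp
  also have "\<dots> = t * (v \<bullet> (G *v v)) + (1 - t) * (v \<bullet> v)"
    by (simp add: P_def matrix_vector_mult_add_rdistrib scaleR_matrix_vector_assoc[symmetric]
        inner_add_right)
  also have "\<dots> > 0"
  proof -
    have "0 < v \<bullet> (G *v v)" "0 < v \<bullet> v"
      using assms \<open>v \<noteq> 0\<close> by (auto simp: positive_definite_def)
    \<comment> \<open>For \<open>t = 0\<close> only \<open>v \<bullet> v\<close> survives. Otherwise
      the first summand is positive and the second merely nonnegative, since \<open>t\<close> may be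
      1.\<close>
    then show ?thesis
      using t by (cases "t = 0") (auto intro!: add_pos_nonneg)
  qed
  finally show False
    by simp
qed

text \<open>By Lindelof countably many members of the cover suffice. Made disjoint, they cut a Borel
  set into countably many pieces, each inside one member, and countable additivity sums the
  agreement on the pieces.\<close>

lemma measure_eqI_open_cover:
  fixes \<mu> \<nu> :: "'a::second_countable_topology measure"
  assumes sets: "sets \<mu> = sets borel" "sets \<nu> = sets borel"
    and "\<And>U. U \<in> \<U> \<Longrightarrow> open U" and "\<Union>\<U> = UNIV"
    and eq: "\<And>U B. U \<in> \<U> \<Longrightarrow> B \<in> sets borel \<Longrightarrow> B \<subseteq> U \<Longrightarrow> emeasure \<mu> B = emeasure \<nu> B"
  shows "\<mu> = \<nu>"
proof -
  obtain \<V> where \<V>: "\<V> \<subseteq> \<U>" "countable \<V>" "\<Union>\<V> = UNIV"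
    using Lindelof[of \<U>] assms(3,4) by metis
  then have "\<V> \<noteq> {}"
    by auto
  \<comment> \<open>The enumeration may repeat members; \<open>disjointed\<close> makes the later
    copies empty.\<close>
  define A where "A = from_nat_into \<V>"
  have A: "A n \<in> \<U>" for n
    using from_nat_into[OF \<open>\<V> \<noteq> {}\<close>] \<V> by (auto simp: A_def)
  have cover: "\<Union>(range (disjointed A)) = UNIV"
    using \<V> \<open>\<V> \<noteq> {}\<close> by (simp add: UN_disjointed_eq A_def range_from_nat_into)
  have "disjointed A n \<in> sets borel" for n
    using assms(3) A by (auto simp: disjointed_def)
  show ?thesis
  proof (rule measure_eqI)
    show "sets \<mu> = sets \<nu>"
      using sets by simp
    fix B
    assume "B \<in> sets \<mu>"
    let ?B = "\<lambda>n. B \<inter> disjointed A n"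
    have B: "?B n \<in> sets borel" for n
      using \<open>B \<in> sets \<mu>\<close> sets \<open>disjointed A n \<in> sets borel\<close> by auto
    have disj: "disjoint_family ?B"
      using disjoint_family_disjointed[of A] by (auto simp: disjoint_family_on_def)
    have B_Un: "(\<Union>n. ?B n) = B"
      using cover by auto
    have "emeasure \<mu> (?B n) = emeasure \<nu> (?B n)" for n
      using eq[OF A[of n] B] disjointed_subset[of A n] by blast
    moreover have sum: "(\<Sum>n. emeasure \<rho> (?B n)) = emeasure \<rho> B" if "sets \<rho> = sets borel" for \<rho>
    proof -
      have "range ?B \<subseteq> sets \<rho>"
        using B that by blast
      from suminf_emeasure[OF this disj] show ?thesis
        unfolding B_Un .
    qed
    ultimately show "emeasure \<mu> B = emeasure \<nu> B"
      unfolding sum[OF sets(1), symmetric] sum[OF sets(2), symmetric] by simp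
  qed
qed

section \<open>Charts\<close>

lemma riemannian_manifold_chart:
  assumes "riemannian_manifold M" "(U, \<phi>) \<in> charts M"
  shows "open U" "open (\<phi> ` U)" "homeomorphism U (\<phi> ` U) \<phi> (inv_into U \<phi>)"
    and "continuous_on (\<phi> ` U) (\<lambda>x. det (metric M (U, \<phi>) x))"
    and "\<And>x. x \<in> \<phi> ` U \<Longrightarrow> 0 < det (metric M (U, \<phi>) x)"
proof -
  show "open U" "open (\<phi> ` U)" "homeomorphism U (\<phi> ` U) \<phi> (inv_into U \<phi>)"
    using assms by (fastforce simp: riemannian_manifold_def maximal_atlas_def is_chart_def)+
  have "smooth_on (metric M (U, \<phi>)) (\<phi> ` U)"
    using assms by (fastforce simp: riemannian_manifold_def)
  then have [continuous_intros]: "continuous_on (\<phi> ` U) (metric M (U, \<phi>))"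
    by (rule smooth_on_imp_continuous_on)
  show "continuous_on (\<phi> ` U) (\<lambda>x. det (metric M (U, \<phi>) x))"
    unfolding det_def by (intro continuous_intros)
  show "0 < det (metric M (U, \<phi>) x)" if "x \<in> \<phi> ` U" for x
    using assms that by (intro det_pos_if_positive_definite) (fastforce simp: riemannian_manifold_def)
qed

lemma charts_cover:
  assumes "riemannian_manifold M"
  shows "\<Union>(fst ` charts M) = UNIV"
  using assms unfolding riemannian_manifold_def maximal_atlas_def by (elim conjE)

lemma inv_into_comp_inv:
  assumes "bij F" "inj_on \<phi> U" "x \<in> \<phi> ` U"
  shows "inv_into (F ` U) (\<phi> \<circ> inv F) x = F (inv_into U \<phi> x)"
proof -
  have "inj_on (\<phi> \<circ> inv F) (F ` U)"
    using assms(1,2) by (auto simp: inj_on_def bij_def)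
  moreover have "F (inv_into U \<phi> x) \<in> F ` U"
    using assms(3) by (simp add: inv_into_into)
  moreover have "(\<phi> \<circ> inv F) (F (inv_into U \<phi> x)) = x"
    using assms by (simp add: bij_is_inj f_inv_into_f)
  ultimately show ?thesis
    by (metis inv_into_f_f)
qed

lemma image_comp_inv:
  assumes "bij F"
  shows "(\<phi> \<circ> inv F) ` B = \<phi> ` (F -` B)"
  by (simp only: image_comp[symmetric] bij_vimage_eq_inv_image[OF assms])

text \<open>The atlas of \<open>L\<close> is maximal, so compatibility with each of its charts is
  enough. The transition maps to and from such a chart are the coordinate expressions of
  \<open>F\<close> and \<open>inv F\<close>, which are smooth by hypothesis.\<close>

lemma transported_chart:
  assumes M: "riemannian_manifold M" and L: "riemannian_manifold L"
    and F: "diffeomorphism M L F" and c: "(U, \<phi>) \<in> charts M"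
  shows "(F ` U, \<phi> \<circ> inv F) \<in> charts L"
proof -
  have bij: "bij F" and FM: "smooth_map M L F" and FL: "smooth_map L M (inv F)"
    using F by (auto simp: diffeomorphism_def)
  note U = riemannian_manifold_chart[OF M c]
  have inj: "inj_on \<phi> U"
    using U(3) by (metis homeomorphism_def inj_on_inverseI)
  have contF: "continuous_on S F" and contF': "continuous_on T (inv F)" for S T
    using FM FL by (auto simp: smooth_map_def intro: continuous_on_subset)
  \<comment> \<open>Written as a preimage under \<open>inv F\<close>, the new domain is open by
    continuity of \<open>inv F\<close>.\<close>
  have FU: "F ` U = inv F -` U"
    using bij by (metis bij_imp_bij_inv bij_vimage_eq_inv_image inv_inv_eq)
  have openFU: "open (F ` U)"
    unfolding FU using U(1) contF'[of UNIV] by (rule open_vimage)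
  have img: "(\<phi> \<circ> inv F) ` F ` U = \<phi> ` U"
    unfolding image_comp_inv[OF bij] by (simp add: bij bij_is_inj inj_vimage_image_eq)
  have inv_eq: "inv_into (F ` U) (\<phi> \<circ> inv F) x = F (inv_into U \<phi> x)" if "x \<in> \<phi> ` U" for x
    using inv_into_comp_inv[OF bij inj that] .
  have "homeomorphism (F ` U) (\<phi> ` U) (\<phi> \<circ> inv F) (F \<circ> inv_into U \<phi>)"
  proof (rule homeomorphism_compose)
    show "homeomorphism (F ` U) U (inv F) F"
      using bij contF contF'
      by (auto simp: homeomorphism_def bij_is_inj bij_is_surj surj_f_inv_f image_comp)
  qed (rule U(3))
  then have "homeomorphism (F ` U) (\<phi> ` U) (\<phi> \<circ> inv F) (inv_into (F ` U) (\<phi> \<circ> inv F))"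
    by (rule homeomorphism_cong) (auto simp: inv_eq)
  then have chart: "is_chart (F ` U, \<phi> \<circ> inv F)"
    using openFU U(2) img by (simp add: is_chart_def)
  have "compatible (F ` U, \<phi> \<circ> inv F) (V, \<psi>)" if d: "(V, \<psi>) \<in> charts L" for V \<psi>
  proof -
    have "smooth_on (\<psi> \<circ> F \<circ> inv_into U \<phi>) (\<phi> ` (U \<inter> F -` V))"
      using FM c d by (fastforce simp: smooth_map_def)
    moreover have "(\<phi> \<circ> inv F) ` (F ` U \<inter> V) = \<phi> ` (U \<inter> F -` V)"
      unfolding image_comp_inv[OF bij] by (simp add: bij bij_is_inj inj_vimage_image_eq)
    \<comment> \<open>The two maps are known to agree only on the image of \<open>U\<close> under
      \<phi>, an open set containing the domain in question; this is where locality of smoothness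
      enters.\<close>
    ultimately have "smooth_on (transition (F ` U, \<phi> \<circ> inv F) (V, \<psi>)) ((\<phi> \<circ> inv F) ` (F ` U \<inter> V))"
      using smooth_on_cong[OF U(2), of "\<phi> ` (U \<inter> F -` V)" "\<psi> \<circ> F \<circ> inv_into U \<phi>"
          "transition (F ` U, \<phi> \<circ> inv F) (V, \<psi>)"]
      by (simp add: transition_def inv_eq image_mono)
    \<comment> \<open>In this direction the transition map is literally the coordinate expression of
      \<open>inv F\<close>, so only the domain has to be rewritten.\<close>
    moreover have "smooth_on (\<phi> \<circ> inv F \<circ> inv_into V \<psi>) (\<psi> ` (V \<inter> inv F -` U))"
      using FL c d by (fastforce simp: smooth_map_def)
    then have "smooth_on (transition (V, \<psi>) (F ` U, \<phi> \<circ> inv F)) (\<psi> ` (F ` U \<inter> V))"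
      by (simp add: transition_def FU Int_commute)
    ultimately show ?thesis
      by (simp add: compatible_def)
  qed
  then have "\<forall>d\<in>charts L. compatible (F ` U, \<phi> \<circ> inv F) d"
    by auto
  moreover have "\<forall>c. is_chart c \<and> (\<forall>d\<in>charts L. compatible c d) \<longrightarrow> c \<in> charts L"
    using L unfolding riemannian_manifold_def maximal_atlas_def by (elim conjE)
  ultimately show ?thesis
    using chart by simp
qed

text \<open>The tensor law multiplies by the Jacobian matrix and by its transpose, which have the
  same determinant; hence the square.\<close>

lemma det_metric_transition:
  assumes M: "riemannian_manifold M" and "(U, \<phi>) \<in> charts M" "(V, \<psi>) \<in> charts M"
    and "p \<in> U" "p \<in> V"
  shows "det (metric M (U, \<phi>) (\<phi> p)) =
    (det (jacobian (transition (U, \<phi>) (V, \<psi>)) (at (\<phi> p))))\<^sup>2 * det (metric M (V, \<psi>) (\<psi> p))"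
proof -
  have "metric M (U, \<phi>) (\<phi> p) =
      transpose (jacobian (transition (U, \<phi>) (V, \<psi>)) (at (\<phi> p))) ** metric M (V, \<psi>) (\<psi> p) **
      jacobian (transition (U, \<phi>) (V, \<psi>)) (at (\<phi> p))"
    using assms unfolding riemannian_manifold_def Let_def by fast
  then show ?thesis
    by (simp add: det_mul power2_eq_square)
qed

section \<open>The volume ratio\<close>

text \<open>Charts transported along \<open>F\<close> have the same transition maps as the original ones, so the
  Jacobian determinants cancel in the quotient.\<close>

lemma volume_ratio_chart:
  assumes M: "riemannian_manifold M" and L: "riemannian_manifold L"
    and F: "diffeomorphism M L F" and c: "(U, \<phi>) \<in> charts M" and p: "p \<in> U"
  shows "volume_ratio M L F p =
    sqrt (det (metric L (F ` U, \<phi> \<circ> inv F) (\<phi> p)) / det (metric M (U, \<phi>) (\<phi> p)))"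
proof -
  have bij: "bij F"
    using F by (simp add: diffeomorphism_def)
  obtain V \<psi> where V\<psi>: "(SOME c. c \<in> charts M \<and> p \<in> fst c) = (V, \<psi>)"
    by (rule prod.exhaust)
  have "(SOME c. c \<in> charts M \<and> p \<in> fst c) \<in> charts M \<and> p \<in> fst (SOME c. c \<in> charts M \<and> p \<in> fst c)"
    by (rule someI[where x = "(U, \<phi>)"]) (simp add: c p)
  then have d: "(V, \<psi>) \<in> charts M" and pV: "p \<in> V"
    unfolding V\<psi> by simp_all
  note U = riemannian_manifold_chart[OF M c]
  have inj: "inj_on \<phi> U"
    using U(3) by (metis homeomorphism_def inj_on_inverseI)
  let ?J = "jacobian (transition (U, \<phi>) (V, \<psi>)) (at (\<phi> p))"
  \<comment> \<open>On the open image of \<open>U\<close> under \<phi> the factors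
    \<open>inv F\<close> and \<open>F\<close> cancel, and the Jacobian depends only on values near
    \<open>\<phi> p\<close>.\<close>
  have "jacobian (transition (F ` U, \<phi> \<circ> inv F) (F ` V, \<psi> \<circ> inv F)) (at (\<phi> p)) = ?J"
    unfolding jacobian_def
  proof (rule arg_cong[where f = matrix], rule frechet_derivative_cong_open[OF U(2)])
    show "\<phi> p \<in> \<phi> ` U"
      using p by simp
  qed (simp add: transition_def inv_into_comp_inv[OF bij inj] bij_is_inj[OF bij])
  then have "det (metric L (F ` U, \<phi> \<circ> inv F) (\<phi> p)) =
      (det ?J)\<^sup>2 * det (metric L (F ` V, \<psi> \<circ> inv F) (\<psi> p))"
    using det_metric_transition[OF L transported_chart[OF M L F c] transported_chart[OF M L F d],
        of "F p"] p pV by (simp add: bij_is_inj[OF bij])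
  moreover have "det (metric M (U, \<phi>) (\<phi> p)) = (det ?J)\<^sup>2 * det (metric M (V, \<psi>) (\<psi> p))"
    by (rule det_metric_transition[OF M c d p pV])
  moreover have "det (metric M (U, \<phi>) (\<phi> p)) > 0"
    using U(5) p by simp
  \<comment> \<open>Positivity of the determinant on \<open>M\<close> forces \<open>det ?J\<close>
    to be nonzero, so its square can be cancelled.\<close>
  ultimately have "det (metric L (F ` U, \<phi> \<circ> inv F) (\<phi> p)) / det (metric M (U, \<phi>) (\<phi> p)) =
      det (metric L (F ` V, \<psi> \<circ> inv F) (\<psi> p)) / det (metric M (V, \<psi>) (\<psi> p))"
    by (auto simp: zero_less_mult_iff)
  then show ?thesis
    by (simp add: volume_ratio_def V\<psi> Let_def)
qed

text \<open>A transported chart has the same coordinate domain as the original one, so the chart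
  facts for \<open>L\<close> hold over the image of \<open>U\<close> under \<phi>.\<close>

lemma transported_metric:
  assumes M: "riemannian_manifold M" and L: "riemannian_manifold L"
    and F: "diffeomorphism M L F" and c: "(U, \<phi>) \<in> charts M"
  shows "continuous_on (\<phi> ` U) (\<lambda>x. det (metric L (F ` U, \<phi> \<circ> inv F) x))"
    and "\<And>x. x \<in> \<phi> ` U \<Longrightarrow> 0 < det (metric L (F ` U, \<phi> \<circ> inv F) x)"
proof -
  have "bij F"
    using F by (simp add: diffeomorphism_def)
  then have "(\<phi> \<circ> inv F) ` F ` U = \<phi> ` U"
    unfolding image_comp_inv[OF \<open>bij F\<close>] by (simp add: bij_is_inj inj_vimage_image_eq)
  then show "continuous_on (\<phi> ` U) (\<lambda>x. det (metric L (F ` U, \<phi> \<circ> inv F) x))"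
    and "\<And>x. x \<in> \<phi> ` U \<Longrightarrow> 0 < det (metric L (F ` U, \<phi> \<circ> inv F) x)"
    using riemannian_manifold_chart(4,5)[OF L transported_chart[OF assms]] by simp_all
qed

text \<open>Ensures that \<open>ennreal\<close> does not truncate W when W serves as a
  density.\<close>

lemma volume_ratio_pos:
  assumes M: "riemannian_manifold M" and L: "riemannian_manifold L"
    and F: "diffeomorphism M L F"
  shows "0 < volume_ratio M L F p"
proof -
  have "p \<in> \<Union>(fst ` charts M)"
    using charts_cover[OF M] by simp
  then obtain U \<phi> where c: "(U, \<phi>) \<in> charts M" and p: "p \<in> U"
    by auto
  show ?thesis
    using volume_ratio_chart[OF assms c p] p riemannian_manifold_chart(5)[OF M c]
      transported_metric(2)[OF assms c] by simp
qed

text \<open>The definition picks a chart separately at each point, which hides continuity. By chart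
  independence a single chart gives W on its whole open domain as the root of a quotient of
  continuous functions.\<close>

lemma continuous_on_volume_ratio:
  assumes M: "riemannian_manifold M" and L: "riemannian_manifold L"
    and F: "diffeomorphism M L F"
  shows "continuous_on UNIV (volume_ratio M L F)"
proof -
  have "continuous_on U (volume_ratio M L F)" if c: "(U, \<phi>) \<in> charts M" for U \<phi>
  proof -
    note U = riemannian_manifold_chart[OF M c]
    have \<phi>: "continuous_on U \<phi>"
      using U(3) by (simp add: homeomorphism_def)
    have "continuous_on U (\<lambda>p. sqrt (det (metric L (F ` U, \<phi> \<circ> inv F) (\<phi> p)) /
        det (metric M (U, \<phi>) (\<phi> p))))"
    proof (intro continuous_intros)
      show "continuous_on U (\<lambda>p. det (metric M (U, \<phi>) (\<phi> p)))"
        by (rule continuous_on_compose2[OF U(4) \<phi>]) auto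
      show "continuous_on U (\<lambda>p. det (metric L (F ` U, \<phi> \<circ> inv F) (\<phi> p)))"
        by (rule continuous_on_compose2[OF transported_metric(1)[OF assms c] \<phi>]) auto
      show "\<forall>p\<in>U. det (metric M (U, \<phi>) (\<phi> p)) \<noteq> 0"
        using U(5) by force
    qed
    then show ?thesis
      by (simp add: volume_ratio_chart[OF assms c] cong: continuous_on_cong)
  qed
  then have "continuous_on (\<Union>(fst ` charts M)) (volume_ratio M L F)"
    using riemannian_manifold_chart(1)[OF M] by (intro continuous_on_open_Union) auto
  then show ?thesis
    by (simp add: charts_cover[OF M])
qed

section \<open>The Riemannian measures\<close>

text \<open>The definition of the Riemannian measure speaks of Borel sets only. It says that \<mu>
  restricted to \<open>U\<close> is the image of a weighted Lebesgue measure under the inverse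
  coordinate map, and image measures and densities have integration rules for functions.\<close>

lemma nn_integral_riemannian_measure_chart:
  fixes M :: "('a::{t2_space,second_countable_topology}, 'n::finite) manifold"
  assumes M: "riemannian_manifold M" and \<mu>: "riemannian_measure M \<mu>"
    and c: "(U, \<phi>) \<in> charts M"
    and w [measurable]: "w \<in> borel_measurable borel"
  shows "(\<integral>\<^sup>+p\<in>U. w p \<partial>\<mu>) =
    (\<integral>\<^sup>+x\<in>\<phi> ` U. w (inv_into U \<phi> x) * ennreal (sqrt (det (metric M (U, \<phi>) x))) \<partial>lborel)"
proof -
  note U = riemannian_manifold_chart[OF M c]
  have [measurable_cong, simp]: "sets \<mu> = sets borel"
    using \<mu> by (simp add: riemannian_measure_def)
  have [measurable]: "U \<in> sets borel" "\<phi> ` U \<in> sets borel"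
    using U(1,2) by simp_all
  \<comment> \<open>The constant value off the coordinate domain makes \<open>T\<close> Borel on the
    whole space; it never matters, because the density \<open>s\<close> below vanishes
    there.\<close>
  define T where "T x = (if x \<in> \<phi> ` U then inv_into U \<phi> x else undefined)" for x
  have [measurable]: "T \<in> borel_measurable borel"
    unfolding T_def using U(2,3) by (intro borel_measurable_continuous_on_if)
      (auto simp: homeomorphism_def)
  define s where "s x = (if x \<in> \<phi> ` U then sqrt (det (metric M (U, \<phi>) x)) else 0)" for x
  have [measurable]: "s \<in> borel_measurable borel"
    unfolding s_def using U(2,4) by (intro borel_measurable_continuous_on_if)
      (auto intro!: continuous_intros)
  have "density \<mu> (indicator U) = distr (density lborel (\<lambda>x. ennreal (s x))) borel T"
  proof (rule measure_eqI)
    fix B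
    assume "B \<in> sets (density \<mu> (indicator U))"
    then have [measurable]: "B \<in> sets borel"
      by simp
    have ind: "indicator (\<phi> ` (U \<inter> B)) x = (indicator (\<phi> ` U) x * indicator B (T x) :: ennreal)" for x
      using U(3) by (auto simp: T_def indicator_def homeomorphism_def)
    have "emeasure (density \<mu> (indicator U)) B = emeasure \<mu> (U \<inter> B)"
      by (subst emeasure_density) (simp_all add: nn_integral_indicator[symmetric] indicator_inter_arith
          del: nn_integral_indicator)
    also have "\<dots> = (\<integral>\<^sup>+x\<in>\<phi> ` (U \<inter> B). ennreal (sqrt (det (metric M (U, \<phi>) x))) \<partial>lborel)"
    proof -
      have "U \<inter> B \<in> sets borel" "U \<inter> B \<subseteq> U"
        by simp_all
      then show ?thesis
        using \<mu> c unfolding riemannian_measure_def by fast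
    qed
    also have "\<dots> = (\<integral>\<^sup>+x. ennreal (s x) * indicator B (T x) \<partial>lborel)"
      unfolding ind by (intro nn_integral_cong) (simp add: s_def split: split_indicator)
    also have "\<dots> = (\<integral>\<^sup>+x. ennreal (s x) * indicator (T -` B) x \<partial>lborel)"
      by (simp add: indicator_def)
    also have "\<dots> = emeasure (distr (density lborel (\<lambda>x. ennreal (s x))) borel T) B"
      using measurable_sets_borel[of T borel B]
      by (subst emeasure_distr, simp_all, subst emeasure_density, simp_all)
    finally show "emeasure (density \<mu> (indicator U)) B =
        emeasure (distr (density lborel (\<lambda>x. ennreal (s x))) borel T) B" .
  qed simp
  then have "(\<integral>\<^sup>+p. w p \<partial>density \<mu> (indicator U)) =
      (\<integral>\<^sup>+p. w p \<partial>distr (density lborel (\<lambda>x. ennreal (s x))) borel T)"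
    by simp
  then have "(\<integral>\<^sup>+p\<in>U. w p \<partial>\<mu>) = (\<integral>\<^sup>+x. ennreal (s x) * w (T x) \<partial>lborel)"
    by (simp add: nn_integral_distr nn_integral_density mult.commute)
  also have "\<dots> =
    (\<integral>\<^sup>+x\<in>\<phi> ` U. w (inv_into U \<phi> x) * ennreal (sqrt (det (metric M (U, \<phi>) x))) \<partial>lborel)"
    by (intro nn_integral_cong) (simp add: s_def T_def mult.commute split: split_indicator)
  finally show ?thesis .
qed

text \<open>It suffices to compare Borel sets inside the image of one chart domain. There both sides
  become the same coordinate integral, because W times the density of \<mu> is the density of
  \<nu>.\<close>

lemma riemannian_measure_eq_distr_density:
  fixes M :: "('a::{t2_space,second_countable_topology}, 'n::finite) manifold"
    and L :: "('b::{t2_space,second_countable_topology}, 'n) manifold"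
  assumes M: "riemannian_manifold M" and L: "riemannian_manifold L"
    and F: "diffeomorphism M L F"
    and \<mu>: "riemannian_measure M \<mu>" and \<nu>: "riemannian_measure L \<nu>"
  shows "\<nu> = distr (density \<mu> (\<lambda>p. ennreal (volume_ratio M L F p))) borel F"
proof (rule measure_eqI_open_cover)
  let ?\<U> = "(`) F ` fst ` charts M"
  have bij: "bij F"
    using F by (simp add: diffeomorphism_def)
  have [measurable]: "F \<in> borel_measurable borel"
    using F by (intro borel_measurable_continuous_onI)
      (simp add: diffeomorphism_def smooth_map_def)
  have [measurable]: "volume_ratio M L F \<in> borel_measurable borel"
    using continuous_on_volume_ratio[OF M L F] by (rule borel_measurable_continuous_onI)
  have [measurable_cong, simp]: "sets \<mu> = sets borel"
    using \<mu> by (simp add: riemannian_measure_def)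
  then have space: "space \<mu> = UNIV"
    by (metis sets_eq_imp_space_eq space_borel)
  show "sets \<nu> = sets borel"
    using \<nu> by (simp add: riemannian_measure_def)
  show "\<Union>?\<U> = UNIV"
    using charts_cover[OF M] bij by (metis bij_is_surj image_Union)
  show "open V" if "V \<in> ?\<U>" for V
    using that riemannian_manifold_chart(1)[OF L transported_chart[OF M L F]] by auto
  show "emeasure \<nu> B = emeasure (distr (density \<mu> (\<lambda>p. ennreal (volume_ratio M L F p))) borel F) B"
    if V: "V \<in> ?\<U>" and B [measurable]: "B \<in> sets borel" and "B \<subseteq> V" for V B
  proof -
    obtain U \<phi> where c: "(U, \<phi>) \<in> charts M" and "V = F ` U"
      using V by auto
    note U = riemannian_manifold_chart[OF M c]
    let ?h = "\<lambda>x. det (metric L (F ` U, \<phi> \<circ> inv F) x)" and ?g = "\<lambda>x. det (metric M (U, \<phi>) x)"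
    let ?A = "F -` B"
    have [measurable]: "?A \<in> sets borel"
      using measurable_sets_borel[of F borel B] by simp
    have "?A \<subseteq> U"
      using \<open>B \<subseteq> V\<close> \<open>V = F ` U\<close> bij by (auto simp: bij_def inj_on_def)
    have "emeasure (distr (density \<mu> (\<lambda>p. ennreal (volume_ratio M L F p))) borel F) B =
        (\<integral>\<^sup>+p\<in>?A. ennreal (volume_ratio M L F p) \<partial>\<mu>)"
      by (simp add: emeasure_distr emeasure_density space)
    \<comment> \<open>Moving the indicator of \<open>?A\<close> into the integrand leaves an
      integral over all of \<open>U\<close>, as the chart formula requires.\<close>
    also have "\<dots> = (\<integral>\<^sup>+p\<in>U. (ennreal (volume_ratio M L F p) * indicator ?A p) \<partial>\<mu>)"
      using \<open>?A \<subseteq> U\<close> by (intro nn_integral_cong) (auto split: split_indicator)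
    also have "\<dots> = (\<integral>\<^sup>+x\<in>\<phi> ` U. (ennreal (volume_ratio M L F (inv_into U \<phi> x)) *
        indicator ?A (inv_into U \<phi> x)) * ennreal (sqrt (?g x)) \<partial>lborel)"
      by (intro nn_integral_riemannian_measure_chart[OF M \<mu> c]) measurable
    also have "\<dots> = (\<integral>\<^sup>+x\<in>\<phi> ` ?A. ennreal (sqrt (?h x)) \<partial>lborel)"
    proof (intro nn_integral_cong)
      fix x
      show "ennreal (volume_ratio M L F (inv_into U \<phi> x)) * indicator ?A (inv_into U \<phi> x) *
          ennreal (sqrt (?g x)) * indicator (\<phi> ` U) x = ennreal (sqrt (?h x)) * indicator (\<phi> ` ?A) x"
      proof (cases "x \<in> \<phi> ` U")
        case True
        then have x: "inv_into U \<phi> x \<in> U" "\<phi> (inv_into U \<phi> x) = x"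
          by (simp_all add: inv_into_into f_inv_into_f)
        have pos: "0 < ?g x" "0 < ?h x"
          using U(5) transported_metric(2)[OF M L F c] True by simp_all
        have "volume_ratio M L F (inv_into U \<phi> x) * sqrt (?g x) = sqrt (?h x)"
          using volume_ratio_chart[OF M L F c x(1)] x(2) pos by (simp add: real_sqrt_divide)
        then have "ennreal (volume_ratio M L F (inv_into U \<phi> x)) * ennreal (sqrt (?g x)) =
            ennreal (sqrt (?h x))"
          using volume_ratio_pos[OF M L F] pos by (simp add: ennreal_mult''[symmetric])
        \<comment> \<open>This uses that \<phi> is injective on \<open>U\<close> and that
          \<open>?A\<close> lies in \<open>U\<close>.\<close>
        moreover have "inv_into U \<phi> x \<in> ?A \<longleftrightarrow> x \<in> \<phi> ` ?A"
        proof
          assume "x \<in> \<phi> ` ?A"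
          then obtain p where "p \<in> ?A" "x = \<phi> p" by auto
          then show "inv_into U \<phi> x \<in> ?A"
            using U(3) \<open>?A \<subseteq> U\<close> by (metis homeomorphism_apply1 subsetD)
        qed (use x in force)
        ultimately show ?thesis
          using True by (simp add: mult.commute mult.left_commute indicator_def)
      qed (use \<open>?A \<subseteq> U\<close> in \<open>auto simp: indicator_def\<close>)
    qed
    also have "\<dots> = emeasure \<nu> B"
    proof -
      have "emeasure \<nu> B = (\<integral>\<^sup>+x\<in>(\<phi> \<circ> inv F) ` B. ennreal (sqrt (?h x)) \<partial>lborel)"
        using \<nu> transported_chart[OF M L F c] B \<open>B \<subseteq> V\<close>
        unfolding riemannian_measure_def \<open>V = F ` U\<close> by fast
      then show ?thesis
        by (simp only: image_comp_inv[OF bij])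
    qed
    finally show ?thesis
      by simp
  qed
qed simp

section \<open>Transfer of the quadrature formula\<close>

theorem proposition6p1:
  fixes M :: "('a::{t2_space,second_countable_topology}, 'n::finite) manifold"
    and L :: "('b::{t2_space,second_countable_topology}, 'n) manifold"
    and F :: "'a \<Rightarrow> 'b"
    and \<mu> :: "'a measure" and \<nu> :: "'b measure"
    and X :: "'b set"
    and C :: "'a \<Rightarrow> real"
    and E :: "('a \<Rightarrow> real) \<Rightarrow> real"
  assumes "riemannian_manifold M" and "compact (UNIV :: 'a set)" and "homogeneous M"
    and "riemannian_manifold L"
    and "diffeomorphism M L F"
    and "riemannian_measure M \<mu>" and "riemannian_measure L \<nu>"
    and "quadrature_formula \<mu> (F -` X) C E"
  shows "quadrature_formula \<nu> X
           (\<lambda>\<xi>. volume_ratio M L F (inv F \<xi>) * C (inv F \<xi>))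
           (\<lambda>f. E (\<lambda>p. volume_ratio M L F p * f (F p)))"
proof -
  let ?W = "volume_ratio M L F"
  let ?c = "\<lambda>\<xi>. ?W (inv F \<xi>) * C (inv F \<xi>)"
  have bij: "bij F" and contF: "continuous_on UNIV F"
    using assms(5) by (auto simp: diffeomorphism_def smooth_map_def)
  have contW: "continuous_on UNIV ?W"
    by (rule continuous_on_volume_ratio[OF assms(1,4,5)])
  have fin: "finite (F -` X)"
    and quad: "\<And>u. continuous_on UNIV u \<Longrightarrow>
      \<bar>(\<integral>p. u p \<partial>\<mu>) - quadrature_sum (F -` X) C u\<bar> \<le> E u"
    using assms(8) by (auto simp: quadrature_formula_def)
  \<comment> \<open>Surjectivity of \<open>F\<close> gives this; it yields finiteness of
    \<open>X\<close> and the reindexing of the sum by centers on \<open>M\<close>.\<close>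
  have X: "X = F ` (F -` X)"
    using bij by (simp add: bij_is_surj surj_image_vimage_eq)
  have [measurable_cong]: "sets \<mu> = sets borel"
    using assms(6) by (simp add: riemannian_measure_def)
  have "\<bar>(\<integral>y. f y \<partial>\<nu>) - quadrature_sum X ?c f\<bar> \<le> E (\<lambda>p. ?W p * f (F p))"
    if f: "continuous_on UNIV f" for f :: "'b \<Rightarrow> real"
  proof -
    have [measurable]: "F \<in> borel_measurable borel" "?W \<in> borel_measurable borel"
        "f \<in> borel_measurable borel"
      using contF contW f by (simp_all add: borel_measurable_continuous_onI)
    have "(\<integral>y. f y \<partial>\<nu>) = (\<integral>p. ?W p * f (F p) \<partial>\<mu>)"
      using volume_ratio_pos[OF assms(1,4,5)]
      by (subst riemannian_measure_eq_distr_density[OF assms(1,4,5,6,7)])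
        (simp add: integral_distr integral_density less_imp_le)
    moreover have "quadrature_sum X ?c f = quadrature_sum (F -` X) C (\<lambda>p. ?W p * f (F p))"
    proof -
      have "inj_on F (F -` X)"
        using bij by (auto simp: bij_def inj_on_def)
      then have "quadrature_sum (F ` (F -` X)) ?c f =
          quadrature_sum (F -` X) C (\<lambda>p. ?W p * f (F p))"
        unfolding quadrature_sum_def
        by (subst sum.reindex) (auto simp: bij_is_inj[OF bij] mult_ac)
      then show ?thesis
        using X by simp
    qed
    \<comment> \<open>Integral and sum on \<open>L\<close> are now those of one function on
      \<open>M\<close>. Its continuity admits it to the given formula, and the error bound for
      \<open>f\<close> is \<open>E\<close> at this function.\<close>
    moreover have "continuous_on UNIV (\<lambda>p. ?W p * f (F p))"
      using contW continuous_on_compose2[OF f contF] by (intro continuous_intros) auto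
    ultimately show ?thesis
      using quad[of "\<lambda>p. ?W p * f (F p)"] by simp
  qed
  moreover have "finite X"
    using fin X by (metis finite_imageI)
  ultimately show ?thesis
    by (simp add: quadrature_formula_def)
qed

end
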